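(* Let $A$ be a commutative ring with nonzero identity, let $M$ be an $A$-module, let $P$ be a submodule of $M$ and let $F$ be a faithfully flat $A$-module. Then $P$ is a classical 1-absorbing prime submodule of $M$ if and only if $F\otimes P$ is a classical 1-absorbing prime submodule of the $A$-module $F\otimes M$.
   Context: All rings are commutative with nonzero identity; the given modules are nonzero and unital. Tensor products are over $A$; since $F$ is flat, $F\otimes P$ is regarded as a submodule of $F\otimes M$ via the injective map induced by the inclusion $P\subseteq M$. A proper submodule $P$ of an $A$-module $M$ is a classical 1-absorbing prime submodule if whenever $abcm\in P$ for nonunits $a,b,c\in A$ and $m\in M$, then $abm\in P$ or $cm\in P$. *)

theory Defs
  imports "HOL-Algebra.Module" "HOL-Algebra.AbelCoset" "HOL.Hull"
begin

text \<open>
  Modules are records extending rings (HOL-Algebra); the ring fields \<open>mult\<close> and \<open>one\<close>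
  play no role and are left undefined in the constructions below.
\<close>

definition linear_maps ::
    "('a, 'k) ring_scheme \<Rightarrow> ('a, 'm, 'p) module_scheme \<Rightarrow> ('a, 'n, 'q) module_scheme \<Rightarrow> ('m \<Rightarrow> 'n) set"
  where "linear_maps A M N =
    {f \<in> carrier M \<rightarrow> carrier N.
      (\<forall>x\<in>carrier M. \<forall>y\<in>carrier M. f (x \<oplus>\<^bsub>M\<^esub> y) = f x \<oplus>\<^bsub>N\<^esub> f y) \<and>
      (\<forall>a\<in>carrier A. \<forall>x\<in>carrier M. f (a \<odot>\<^bsub>M\<^esub> x) = a \<odot>\<^bsub>N\<^esub> f x)}"

definition classical_1_absorbing_prime_submodule ::
    "('a, 'k) ring_scheme \<Rightarrow> ('a, 'm, 'p) module_scheme \<Rightarrow> 'm set \<Rightarrow> bool"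
  where "classical_1_absorbing_prime_submodule A M P \<longleftrightarrow>
    submodule P A M \<and> P \<noteq> carrier M \<and>
    (\<forall>a \<in> carrier A - Units A. \<forall>b \<in> carrier A - Units A. \<forall>c \<in> carrier A - Units A.
      \<forall>m \<in> carrier M.
        (a \<otimes>\<^bsub>A\<^esub> b \<otimes>\<^bsub>A\<^esub> c) \<odot>\<^bsub>M\<^esub> m \<in> P \<longrightarrow> (a \<otimes>\<^bsub>A\<^esub> b) \<odot>\<^bsub>M\<^esub> m \<in> P \<or> c \<odot>\<^bsub>M\<^esub> m \<in> P)"


section \<open>Tensor products\<close>

definition free_module :: "('a, 'k) ring_scheme \<Rightarrow> 's set \<Rightarrow> ('a, 's \<Rightarrow> 'a) module"
  where "free_module A S =
    \<lparr>carrier = {u. range u \<subseteq> carrier A \<and> finite {s. u s \<noteq> \<zero>\<^bsub>A\<^esub>} \<and> {s. u s \<noteq> \<zero>\<^bsub>A\<^esub>} \<subseteq> S},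
     mult = undefined, one = undefined,
     zero = (\<lambda>_. \<zero>\<^bsub>A\<^esub>), add = (\<lambda>u v s. u s \<oplus>\<^bsub>A\<^esub> v s), smult = (\<lambda>a u s. a \<otimes>\<^bsub>A\<^esub> u s)\<rparr>"

definition free_gen :: "('a, 'k) ring_scheme \<Rightarrow> 's \<Rightarrow> 's \<Rightarrow> 'a"
  where "free_gen A s = (\<lambda>t. if t = s then \<one>\<^bsub>A\<^esub> else \<zero>\<^bsub>A\<^esub>)"

definition quotient_module :: "('a, 'm, 'p) module_scheme \<Rightarrow> 'm set \<Rightarrow> ('a, 'm set) module"
  where "quotient_module M H =
    \<lparr>carrier = a_rcosets\<^bsub>M\<^esub> H, mult = undefined, one = undefined,
     zero = H, add = set_add M, smult = (\<lambda>a X. \<Union>x\<in>X. H +>\<^bsub>M\<^esub> (a \<odot>\<^bsub>M\<^esub> x))\<rparr>"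

definition tensor_relations ::
    "('a, 'k) ring_scheme \<Rightarrow> ('a, 'f, 'p) module_scheme \<Rightarrow> ('a, 'n, 'q) module_scheme \<Rightarrow> ('f \<times> 'n \<Rightarrow> 'a) set"
  where "tensor_relations A F N =
    (let L = free_module A (carrier F \<times> carrier N); e = (\<lambda>x y. free_gen A (x, y)) in
      {e (x \<oplus>\<^bsub>F\<^esub> x') y \<ominus>\<^bsub>L\<^esub> (e x y \<oplus>\<^bsub>L\<^esub> e x' y) | x x' y.
         x \<in> carrier F \<and> x' \<in> carrier F \<and> y \<in> carrier N} \<union>
      {e x (y \<oplus>\<^bsub>N\<^esub> y') \<ominus>\<^bsub>L\<^esub> (e x y \<oplus>\<^bsub>L\<^esub> e x y') | x y y'.
         x \<in> carrier F \<and> y \<in> carrier N \<and> y' \<in> carrier N} \<union>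
      {e (a \<odot>\<^bsub>F\<^esub> x) y \<ominus>\<^bsub>L\<^esub> a \<odot>\<^bsub>L\<^esub> e x y | a x y.
         a \<in> carrier A \<and> x \<in> carrier F \<and> y \<in> carrier N} \<union>
      {e x (a \<odot>\<^bsub>N\<^esub> y) \<ominus>\<^bsub>L\<^esub> a \<odot>\<^bsub>L\<^esub> e x y | a x y.
         a \<in> carrier A \<and> x \<in> carrier F \<and> y \<in> carrier N})"

definition tensor_kernel ::
    "('a, 'k) ring_scheme \<Rightarrow> ('a, 'f, 'p) module_scheme \<Rightarrow> ('a, 'n, 'q) module_scheme \<Rightarrow> ('f \<times> 'n \<Rightarrow> 'a) set"
  where "tensor_kernel A F N =
    (\<lambda>H. submodule H A (free_module A (carrier F \<times> carrier N))) hull tensor_relations A F N"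

definition tensor ::
    "('a, 'k) ring_scheme \<Rightarrow> ('a, 'f, 'p) module_scheme \<Rightarrow> ('a, 'n, 'q) module_scheme \<Rightarrow>
     ('a, ('f \<times> 'n \<Rightarrow> 'a) set) module"
  where "tensor A F N =
    quotient_module (free_module A (carrier F \<times> carrier N)) (tensor_kernel A F N)"

definition pure_tensor ::
    "('a, 'k) ring_scheme \<Rightarrow> ('a, 'f, 'p) module_scheme \<Rightarrow> ('a, 'n, 'q) module_scheme \<Rightarrow>
     'f \<Rightarrow> 'n \<Rightarrow> ('f \<times> 'n \<Rightarrow> 'a) set"
  where "pure_tensor A F N x y =
    tensor_kernel A F N +>\<^bsub>free_module A (carrier F \<times> carrier N)\<^esub> free_gen A (x, y)"

text \<open>
  \<open>tensor_map A F N N' f\<close> is the map \<open>id \<otimes> f\<close> from \<open>F \<otimes> N\<close> to \<open>F \<otimes> N'\<close>: the class of a formal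
  combination \<open>u\<close> is sent to the sum of all \<open>u(x, y) \<cdot> (x \<otimes> f y)\<close>, which depends only on the class.
\<close>

definition tensor_map ::
    "('a, 'k) ring_scheme \<Rightarrow> ('a, 'f, 'p) module_scheme \<Rightarrow> ('a, 'n, 'q) module_scheme \<Rightarrow>
     ('a, 'n', 'r) module_scheme \<Rightarrow> ('n \<Rightarrow> 'n') \<Rightarrow> ('f \<times> 'n \<Rightarrow> 'a) set \<Rightarrow> ('f \<times> 'n' \<Rightarrow> 'a) set"
  where "tensor_map A F N N' f X =
    (THE Y. \<exists>u\<in>X. Y =
      (\<Oplus>\<^bsub>tensor A F N'\<^esub>p \<in> {p. u p \<noteq> \<zero>\<^bsub>A\<^esub>}.
         u p \<odot>\<^bsub>tensor A F N'\<^esub> pure_tensor A F N' (fst p) (f (snd p))))"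

text \<open>\<open>F \<otimes> P\<close> as a subset of \<open>F \<otimes> M\<close>, for a submodule \<open>P\<close> of \<open>M\<close>.\<close>

definition tensor_submodule ::
    "('a, 'k) ring_scheme \<Rightarrow> ('a, 'f, 'p) module_scheme \<Rightarrow> ('a, 'm, 'q) module_scheme \<Rightarrow> 'm set \<Rightarrow>
     ('f \<times> 'm \<Rightarrow> 'a) set set"
  where "tensor_submodule A F M P =
    tensor_map A F (M\<lparr>carrier := P\<rparr>) M (\<lambda>x. x) ` carrier (tensor A F (M\<lparr>carrier := P\<rparr>))"


section \<open>Faithful flatness\<close>

definition exact_at ::
    "('a, 'l, 'p) module_scheme \<Rightarrow> ('a, 'm, 'q) module_scheme \<Rightarrow> ('a, 'n, 'r) module_scheme \<Rightarrow>
     ('l \<Rightarrow> 'm) \<Rightarrow> ('m \<Rightarrow> 'n) \<Rightarrow> bool"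
  where "exact_at N' N N'' f g \<longleftrightarrow> f ` carrier N' = a_kernel N N'' g"

text \<open>
  A sequence \<open>N' \<rightarrow> N \<rightarrow> N''\<close> of \<open>A\<close>-modules is exact iff it is exact after tensoring with \<open>F\<close>.
  A definition cannot quantify over types, so the modules tested range over those carried by a
  subset of the type \<open>'u\<close>. This is the usual notion as soon as \<open>'u\<close> has an injective copy of the
  carrier of \<open>A\<close>: the sequences \<open>0 \<rightarrow> I \<rightarrow> A\<close> for ideals \<open>I\<close> yield flatness and
  \<open>0 \<rightarrow> A/\<mm> \<rightarrow> 0\<close> for maximal ideals \<open>\<mm>\<close> yield faithfulness for modules over all types.
  For smaller \<open>'u\<close> it is weaker.
\<close>

definition faithfully_flat ::
    "'u itself \<Rightarrow> ('a, 'k) ring_scheme \<Rightarrow> ('a, 'f, 'p) module_scheme \<Rightarrow> bool"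
  where "faithfully_flat (U :: 'u itself) A F \<longleftrightarrow>
    module A F \<and>
    (\<forall>(N' :: ('a, 'u) module) (N :: ('a, 'u) module) (N'' :: ('a, 'u) module) f g.
      module A N' \<and> module A N \<and> module A N'' \<and> f \<in> linear_maps A N' N \<and> g \<in> linear_maps A N N'' \<longrightarrow>
      (exact_at N' N N'' f g \<longleftrightarrow>
       exact_at (tensor A F N') (tensor A F N) (tensor A F N'')
         (tensor_map A F N' N f) (tensor_map A F N N'' g)))"

end

theory Submission
  imports Defs
begin

text \<open>
  Write \<open>(P : s)\<close> for the submodule of all \<open>m\<close> with \<open>s m \<in> P\<close>. A submodule is never the union of two
  proper submodules of itself, so \<open>P\<close> is classical 1-absorbing prime iff it is proper and, for all
  nonunits \<open>a\<close>, \<open>b\<close>, \<open>c\<close>, the residual \<open>(P : abc)\<close> equals \<open>(P : ab)\<close> or \<open>(P : c)\<close>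
  (\<open>classical_1_absorbing_prime_iff_residuals\<close>). In this form the property only compares submodules.

  It then passes between \<open>P\<close> and \<open>F \<otimes> P\<close> because \<open>Q \<mapsto> F \<otimes> Q\<close> is injective on submodules of \<open>M\<close>,
  sends \<open>M\<close> to \<open>F \<otimes> M\<close>, and satisfies \<open>F \<otimes> (P : s) = (F \<otimes> P : s)\<close>. Injectivity and the last
  equation both come from the single equivalence
  \<open>Q = (P : s) \<longleftrightarrow> F \<otimes> Q = (F \<otimes> P : s)\<close> (\<open>faithfully_flat_residual_iff\<close>), which is faithful flatness
  applied to \<open>Q \<rightarrow> M \<rightarrow> M/P\<close> with second map \<open>m \<mapsto> s m + P\<close>.

  Two things have to be supplied for that application. The map \<open>id \<otimes> f\<close> has to be well defined and
  functorial, which follows from the universal properties of free modules, quotients and tensor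
  products. And \<open>M\<close>, its submodules and \<open>M/P\<close> live on other types than the one over which faithful
  flatness quantifies, so exactness has to be transported along isomorphisms to copies there
  (\<open>faithfully_flat_exact_at_iff\<close>).
\<close>

section \<open>Linear maps\<close>

lemma linear_mapsI:
  assumes "\<And>x. x \<in> carrier M \<Longrightarrow> f x \<in> carrier N"
    and "\<And>x y. \<lbrakk>x \<in> carrier M; y \<in> carrier M\<rbrakk> \<Longrightarrow> f (x \<oplus>\<^bsub>M\<^esub> y) = f x \<oplus>\<^bsub>N\<^esub> f y"
    and "\<And>a x. \<lbrakk>a \<in> carrier A; x \<in> carrier M\<rbrakk> \<Longrightarrow> f (a \<odot>\<^bsub>M\<^esub> x) = a \<odot>\<^bsub>N\<^esub> f x"
  shows "f \<in> linear_maps A M N"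
  using assms by (auto simp: linear_maps_def)

lemma linear_mapsD:
  assumes "f \<in> linear_maps A M N"
  shows "x \<in> carrier M \<Longrightarrow> f x \<in> carrier N"
    and "\<lbrakk>x \<in> carrier M; y \<in> carrier M\<rbrakk> \<Longrightarrow> f (x \<oplus>\<^bsub>M\<^esub> y) = f x \<oplus>\<^bsub>N\<^esub> f y"
    and "\<lbrakk>a \<in> carrier A; x \<in> carrier M\<rbrakk> \<Longrightarrow> f (a \<odot>\<^bsub>M\<^esub> x) = a \<odot>\<^bsub>N\<^esub> f x"
  using assms by (auto simp: linear_maps_def)

lemma linear_maps_cong:
  assumes "module A M" "f \<in> linear_maps A M N" "\<And>x. x \<in> carrier M \<Longrightarrow> g x = f x"
  shows "g \<in> linear_maps A M N"
proof -
  interpret M: module A M by fact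
  show ?thesis
    using assms(2,3) by (auto intro!: linear_mapsI simp: linear_mapsD)
qed

lemma linear_maps_compose:
  assumes "f \<in> linear_maps A L M" "g \<in> linear_maps A M N"
  shows "(\<lambda>x. g (f x)) \<in> linear_maps A L N"
  by (rule linear_mapsI) (use assms in \<open>simp_all add: linear_mapsD\<close>)

lemma linear_maps_id: "(\<lambda>x. x) \<in> linear_maps A M M"
  by (rule linear_mapsI) auto

lemma linear_maps_smult:
  assumes "module A N" "f \<in> linear_maps A M N" "s \<in> carrier A"
  shows "(\<lambda>x. s \<odot>\<^bsub>N\<^esub> f x) \<in> linear_maps A M N"
proof -
  interpret N: module A N by fact
  show ?thesis
  proof (rule linear_mapsI)
    fix a x assume "a \<in> carrier A" "x \<in> carrier M"
    then have "s \<odot>\<^bsub>N\<^esub> (a \<odot>\<^bsub>N\<^esub> f x) = a \<odot>\<^bsub>N\<^esub> (s \<odot>\<^bsub>N\<^esub> f x)"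
      using assms by (simp flip: N.smult_assoc1 add: linear_mapsD N.m_comm)
    then show "s \<odot>\<^bsub>N\<^esub> f (a \<odot>\<^bsub>M\<^esub> x) = a \<odot>\<^bsub>N\<^esub> (s \<odot>\<^bsub>N\<^esub> f x)"
      using assms \<open>a \<in> carrier A\<close> \<open>x \<in> carrier M\<close> by (simp add: linear_mapsD)
  qed (use assms in \<open>auto simp: linear_mapsD N.smult_r_distr\<close>)
qed

lemma linear_maps_zero:
  assumes "module A M" "module A N" "f \<in> linear_maps A M N"
  shows "f \<zero>\<^bsub>M\<^esub> = \<zero>\<^bsub>N\<^esub>"
proof -
  interpret M: module A M by fact
  interpret N: module A N by fact
  have "f (\<zero>\<^bsub>A\<^esub> \<odot>\<^bsub>M\<^esub> \<zero>\<^bsub>M\<^esub>) = \<zero>\<^bsub>A\<^esub> \<odot>\<^bsub>N\<^esub> f \<zero>\<^bsub>M\<^esub>"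
    using assms(3) by (simp add: linear_mapsD del: M.smult_l_null M.smult_r_null)
  then show ?thesis
    using linear_mapsD(1)[OF assms(3)] by simp
qed

lemma linear_maps_minus:
  assumes "module A M" "module A N" "f \<in> linear_maps A M N" "x \<in> carrier M" "y \<in> carrier M"
  shows "f (x \<ominus>\<^bsub>M\<^esub> y) = f x \<ominus>\<^bsub>N\<^esub> f y"
proof -
  interpret M: module A M by fact
  interpret N: module A N by fact
  have "f (x \<ominus>\<^bsub>M\<^esub> y) \<oplus>\<^bsub>N\<^esub> f y = f ((x \<ominus>\<^bsub>M\<^esub> y) \<oplus>\<^bsub>M\<^esub> y)"
    using assms by (simp add: linear_mapsD)
  also have "(x \<ominus>\<^bsub>M\<^esub> y) \<oplus>\<^bsub>M\<^esub> y = x"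
    using assms by (simp add: a_minus_def M.a_assoc M.l_neg)
  finally show ?thesis
    using assms linear_mapsD(1)[OF assms(3)]
    by (metis M.minus_closed N.add.inv_solve_right N.minus_eq)
qed

lemma minus_eq_zero_iff:
  assumes "module A M" "x \<in> carrier M" "y \<in> carrier M"
  shows "x \<ominus>\<^bsub>M\<^esub> y = \<zero>\<^bsub>M\<^esub> \<longleftrightarrow> x = y"
proof -
  interpret M: module A M by fact
  show ?thesis
    using assms by (metis M.add.inv_closed M.add.inv_equality M.minus_eq M.minus_minus M.r_neg)
qed

lemma linear_maps_uminus:
  assumes "module A M" "module A N" "f \<in> linear_maps A M N" "x \<in> carrier M"
  shows "f (\<ominus>\<^bsub>M\<^esub> x) = \<ominus>\<^bsub>N\<^esub> f x"
proof -
  interpret M: module A M by fact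
  interpret N: module A N by fact
  show ?thesis
    using linear_maps_minus[OF assms(1-3) M.zero_closed assms(4)] linear_maps_zero[OF assms(1-3)]
      assms(4) linear_mapsD(1)[OF assms(3,4)] by (simp add: a_minus_def)
qed

lemma zero_mem_submodule:
  assumes "submodule H A M"
  shows "\<zero>\<^bsub>M\<^esub> \<in> H"
  using submodule.axioms(1)[OF assms] subgroup.one_closed by force

lemma submodule_image:
  assumes "module A M" "module A N" "f \<in> linear_maps A M N"
  shows "submodule (f ` carrier M) A N"
proof -
  interpret M: module A M by fact
  interpret N: module A N by fact
  show ?thesis
  proof (rule N.submoduleI)
    show "f ` carrier M \<subseteq> carrier N" using assms(3) by (auto simp: linear_mapsD)
    show "\<zero>\<^bsub>N\<^esub> \<in> f ` carrier M" using linear_maps_zero[OF assms] by force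
    fix y assume "y \<in> f ` carrier M"
    then show "\<ominus>\<^bsub>N\<^esub> y \<in> f ` carrier M"
      using assms by (auto simp flip: linear_maps_uminus)
  next
    fix a b assume "a \<in> f ` carrier M" "b \<in> f ` carrier M"
    then show "a \<oplus>\<^bsub>N\<^esub> b \<in> f ` carrier M"
      using assms(3) by (auto simp flip: linear_mapsD(2))
  next
    fix a b assume "a \<in> carrier A" "b \<in> f ` carrier M"
    then show "a \<odot>\<^bsub>N\<^esub> b \<in> f ` carrier M"
      using assms(3) by (auto simp flip: linear_mapsD(3))
  qed
qed

lemma a_kernel_altdef: "a_kernel M N f = {x \<in> carrier M. f x = \<zero>\<^bsub>N\<^esub>}"
  by (simp add: a_kernel_def kernel_def)

lemma submodule_kernel:
  assumes "module A M" "module A N" "f \<in> linear_maps A M N"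
  shows "submodule (a_kernel M N f) A M"
proof -
  interpret M: module A M by fact
  interpret N: module A N by fact
  show ?thesis
    unfolding a_kernel_altdef
    by (rule M.submoduleI)
      (use assms linear_maps_zero[OF assms] in \<open>auto simp: linear_mapsD linear_maps_uminus\<close>)
qed

section \<open>Transport along injections and isomorphism invariance of exactness\<close>

definition inverse_linear_maps ::
    "('a, 'k) ring_scheme \<Rightarrow> ('a, 'm, 'p) module_scheme \<Rightarrow> ('a, 'n, 'q) module_scheme
      \<Rightarrow> ('m \<Rightarrow> 'n) \<Rightarrow> ('n \<Rightarrow> 'm) \<Rightarrow> bool"
  where "inverse_linear_maps A M N f g \<longleftrightarrow>
    f \<in> linear_maps A M N \<and> g \<in> linear_maps A N M \<and>
    (\<forall>x\<in>carrier M. g (f x) = x) \<and> (\<forall>y\<in>carrier N. f (g y) = y)"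

text \<open>The copy of \<open>M\<close> on \<open>\<phi> ` carrier M\<close>, with the operations read back through the inverse of
  \<open>\<phi>\<close>. It moves a module into the fixed type over which \<^const>\<open>faithfully_flat\<close> quantifies.\<close>
definition transport :: "('m \<Rightarrow> 'u) \<Rightarrow> ('a, 'm, 'p) module_scheme \<Rightarrow> ('a, 'u) module"
  where "transport \<phi> M = (let \<psi> = inv_into (carrier M) \<phi> in
    \<lparr>carrier = \<phi> ` carrier M, mult = undefined, one = undefined,
     zero = \<phi> \<zero>\<^bsub>M\<^esub>, add = (\<lambda>x y. \<phi> (\<psi> x \<oplus>\<^bsub>M\<^esub> \<psi> y)), smult = (\<lambda>a x. \<phi> (a \<odot>\<^bsub>M\<^esub> \<psi> x))\<rparr>)"

lemma transport:
  assumes "module A M" "inj_on \<phi> (carrier M)"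
  shows module_transport: "module A (transport \<phi> M)"
    and inverse_linear_maps_transport:
      "inverse_linear_maps A M (transport \<phi> M) \<phi> (inv_into (carrier M) \<phi>)"
proof -
  interpret M: module A M by fact
  note [simp] = inv_into_f_f[OF assms(2)]
  show "inverse_linear_maps A M (transport \<phi> M) \<phi> (inv_into (carrier M) \<phi>)"
    by (auto simp: inverse_linear_maps_def linear_maps_def transport_def Let_def)
  have "\<exists>y\<in>carrier M. \<phi> (y \<oplus>\<^bsub>M\<^esub> x) = \<phi> \<zero>\<^bsub>M\<^esub>" if "x \<in> carrier M" for x
    using that by (intro bexI[of _ "\<ominus>\<^bsub>M\<^esub> x"]) (auto simp: M.l_neg)
  then have "abelian_group (transport \<phi> M)"
    by (intro abelian_groupI) (auto simp: transport_def Let_def M.a_ac)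
  then show "module A (transport \<phi> M)"
    by (intro moduleI M.R.is_cring)
      (auto simp: transport_def Let_def M.smult_l_distr M.smult_r_distr M.smult_assoc1)
qed

text \<open>An isomorphism of three-term complexes carries the image in the middle term to the image and the
  kernel to the kernel, and on the middle term it is injective, so it reflects equality of the two.
  The maps \<open>f1\<close> and \<open>g1\<close> are fixed only on the carriers because nothing constrains a linear map
  elsewhere.\<close>
lemma exact_at_transfer:
  assumes mod: "module A N''" "module A K''"
    and iso: "inverse_linear_maps A N' K' \<alpha>' \<beta>'" "inverse_linear_maps A N K \<alpha> \<beta>"
      "inverse_linear_maps A N'' K'' \<alpha>'' \<beta>''"
    and fg: "f \<in> linear_maps A N' N" "g \<in> linear_maps A N N''"
    and f1: "\<And>x. x \<in> carrier K' \<Longrightarrow> f1 x = \<alpha> (f (\<beta>' x))"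
    and g1: "\<And>y. y \<in> carrier K \<Longrightarrow> g1 y = \<alpha>'' (g (\<beta> y))"
  shows "exact_at N' N N'' f g \<longleftrightarrow> exact_at K' K K'' f1 g1"
proof -
  note lin = iso[unfolded inverse_linear_maps_def]
  note cl = linear_mapsD(1)[OF fg(1)] linear_mapsD(1)[OF fg(2)]
    linear_mapsD(1)[of \<alpha>' A N' K'] linear_mapsD(1)[of \<beta>' A K' N']
    linear_mapsD(1)[of \<alpha> A N K] linear_mapsD(1)[of \<beta> A K N] 
    linear_mapsD(1)[of \<alpha>'' A N'' K'']
  have inj: "inj_on \<alpha> (carrier N)"
    using lin by (metis inj_onI)
  have "f1 ` carrier K' = \<alpha> ` f ` carrier N'"
  proof safe
    fix x assume "x \<in> carrier K'"
    then show "f1 x \<in> \<alpha> ` f ` carrier N'" using f1 lin cl by auto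
  next
    fix x assume x: "x \<in> carrier N'"
    then have "\<alpha> (f x) = f1 (\<alpha>' x)" using f1 lin cl by simp
    then show "\<alpha> (f x) \<in> f1 ` carrier K'" using x lin cl by auto
  qed
  moreover have zero: "\<alpha>'' z = \<zero>\<^bsub>K''\<^esub> \<longleftrightarrow> z = \<zero>\<^bsub>N''\<^esub>" if "z \<in> carrier N''" for z
    using lin that linear_maps_zero[OF mod] linear_maps_zero[OF mod(2,1)] by metis
  have "a_kernel K K'' g1 = \<alpha> ` a_kernel N N'' g"
  proof safe
    fix y assume y: "y \<in> a_kernel K K'' g1"
    then have "\<beta> y \<in> a_kernel N N'' g" "y = \<alpha> (\<beta> y)"
      using g1 lin cl zero by (auto simp: a_kernel_altdef)
    then show "y \<in> \<alpha> ` a_kernel N N'' g" by blast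
  next
    fix x assume "x \<in> a_kernel N N'' g"
    then show "\<alpha> x \<in> a_kernel K K'' g1"
      using g1 lin cl linear_maps_zero[OF mod] by (simp add: a_kernel_altdef)
  qed
  ultimately show ?thesis
    unfolding exact_at_def
    using inj_on_image_eq_iff[OF inj, of "f ` carrier N'" "a_kernel N N'' g"] cl(1)
    by (simp add: a_kernel_altdef image_subset_iff)
qed

section \<open>Free modules\<close>

lemma free_module_simps:
  "u \<in> carrier (free_module A S) \<longleftrightarrow>
    (\<forall>s. u s \<in> carrier A) \<and> finite {s. u s \<noteq> \<zero>\<^bsub>A\<^esub>} \<and> {s. u s \<noteq> \<zero>\<^bsub>A\<^esub>} \<subseteq> S"
  "\<zero>\<^bsub>free_module A S\<^esub> = (\<lambda>_. \<zero>\<^bsub>A\<^esub>)"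
  "u \<oplus>\<^bsub>free_module A S\<^esub> v = (\<lambda>s. u s \<oplus>\<^bsub>A\<^esub> v s)"
  "a \<odot>\<^bsub>free_module A S\<^esub> u = (\<lambda>s. a \<otimes>\<^bsub>A\<^esub> u s)"
  by (auto simp: free_module_def)

lemma module_free_module:
  assumes "cring A"
  shows "module A (free_module A S)"
proof -
  interpret A: cring A by fact
  have add: "u \<oplus>\<^bsub>free_module A S\<^esub> v \<in> carrier (free_module A S)"
    if "u \<in> carrier (free_module A S)" "v \<in> carrier (free_module A S)" for u v
  proof -
    have "{s. u s \<oplus>\<^bsub>A\<^esub> v s \<noteq> \<zero>\<^bsub>A\<^esub>} \<subseteq> {s. u s \<noteq> \<zero>\<^bsub>A\<^esub>} \<union> {s. v s \<noteq> \<zero>\<^bsub>A\<^esub>}" by auto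
    then show ?thesis
      using that by (auto simp: free_module_simps intro: finite_subset)
  qed
  have smult: "a \<odot>\<^bsub>free_module A S\<^esub> u \<in> carrier (free_module A S)"
    if "a \<in> carrier A" "u \<in> carrier (free_module A S)" for a u
  proof -
    have "{s. a \<otimes>\<^bsub>A\<^esub> u s \<noteq> \<zero>\<^bsub>A\<^esub>} \<subseteq> {s. u s \<noteq> \<zero>\<^bsub>A\<^esub>}" using that by auto
    then show ?thesis
      using that by (auto simp: free_module_simps intro: finite_subset)
  qed
  have "\<exists>v\<in>carrier (free_module A S). v \<oplus>\<^bsub>free_module A S\<^esub> u = \<zero>\<^bsub>free_module A S\<^esub>"
    if "u \<in> carrier (free_module A S)" for u
    using that smult[of "\<ominus>\<^bsub>A\<^esub> \<one>\<^bsub>A\<^esub>" u]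
    by (intro bexI[of _ "(\<ominus>\<^bsub>A\<^esub> \<one>\<^bsub>A\<^esub>) \<odot>\<^bsub>free_module A S\<^esub> u"])
      (auto simp: free_module_simps A.l_minus A.l_neg)
  then have "abelian_group (free_module A S)"
    by (intro abelian_groupI add) (auto simp: free_module_simps A.a_ac)
  then show ?thesis
    by (intro moduleI smult A.is_cring)
      (auto simp: free_module_simps A.l_distr A.r_distr A.m_assoc)
qed

lemma free_gen_closed:
  assumes "cring A" "s \<in> S"
  shows "free_gen A s \<in> carrier (free_module A S)"
proof -
  interpret A: cring A by fact
  have "{t. free_gen A s t \<noteq> \<zero>\<^bsub>A\<^esub>} \<subseteq> {s}" by (auto simp: free_gen_def)
  then show ?thesis
    using assms(2) by (auto simp: free_module_simps free_gen_def intro: finite_subset)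
qed

text \<open>Induction on a finite set containing the support: splitting off the coefficient at \<open>s\<close> leaves
  a combination whose support avoids \<open>s\<close>.\<close>
lemma free_module_induct [consumes 2, case_names zero add gen]:
  assumes "cring A" "u \<in> carrier (free_module A S)"
    and zero: "Q \<zero>\<^bsub>free_module A S\<^esub>"
    and add: "\<And>u v. \<lbrakk>u \<in> carrier (free_module A S); v \<in> carrier (free_module A S); Q u; Q v\<rbrakk>
      \<Longrightarrow> Q (u \<oplus>\<^bsub>free_module A S\<^esub> v)"
    and gen: "\<And>a s. \<lbrakk>a \<in> carrier A; s \<in> S\<rbrakk> \<Longrightarrow> Q (a \<odot>\<^bsub>free_module A S\<^esub> free_gen A s)"
  shows "Q u"
proof -
  interpret A: cring A by fact
  interpret L: module A "free_module A S" by (rule module_free_module) fact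
  have "Q u" if "finite T" "{s. u s \<noteq> \<zero>\<^bsub>A\<^esub>} \<subseteq> T" "u \<in> carrier (free_module A S)" for T u
    using that
  proof (induction T arbitrary: u rule: finite_induct)
    case empty
    then have "u = \<zero>\<^bsub>free_module A S\<^esub>" by (auto simp: free_module_simps)
    then show ?case using zero by simp
  next
    case (insert s T)
    show ?case
    proof (cases "u s = \<zero>\<^bsub>A\<^esub>")
      case True
      then show ?thesis using insert by (metis (mono_tags, lifting) mem_Collect_eq subset_insert)
    next
      case False
      then have s: "s \<in> S" using insert.prems by (auto simp: free_module_simps)
      define v where "v = u(s := \<zero>\<^bsub>A\<^esub>)"
      have sub: "{t. v t \<noteq> \<zero>\<^bsub>A\<^esub>} \<subseteq> {t. u t \<noteq> \<zero>\<^bsub>A\<^esub>}" by (auto simp: v_def)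
      then have v: "v \<in> carrier (free_module A S)"
        using insert.prems finite_subset[OF sub] by (auto simp: free_module_simps v_def)
      have "{t. v t \<noteq> \<zero>\<^bsub>A\<^esub>} \<subseteq> T" using insert.prems by (auto simp: v_def)
      then have "Q v" using insert.IH v by blast
      moreover have us: "u s \<in> carrier A" using insert.prems by (auto simp: free_module_simps)
      moreover have "u = v \<oplus>\<^bsub>free_module A S\<^esub> (u s \<odot>\<^bsub>free_module A S\<^esub> free_gen A s)"
        using us insert.prems(2) by (auto simp: free_module_simps v_def free_gen_def)
      ultimately show ?thesis
        using add[OF v _ \<open>Q v\<close> gen] free_gen_closed[OF assms(1)] s by (metis L.smult_closed)
    qed
  qed
  then show ?thesis using assms(2) by (auto simp: free_module_simps)
qed

lemma free_module_linear_eqI: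
  assumes "cring A" "module A N"
    and f: "f \<in> linear_maps A (free_module A S) N" and g: "g \<in> linear_maps A (free_module A S) N"
    and gen: "\<And>s. s \<in> S \<Longrightarrow> f (free_gen A s) = g (free_gen A s)"
    and "u \<in> carrier (free_module A S)"
  shows "f u = g u"
  using assms(1,6)
proof (induction rule: free_module_induct)
  case zero
  show ?case
    using linear_maps_zero[OF module_free_module[OF assms(1)] assms(2)] f g by metis
qed (simp_all add: linear_mapsD[OF f] linear_mapsD[OF g] free_gen_closed[OF assms(1)] gen)

text \<open>The linear extension of \<open>\<phi>\<close> to the free module. The sum is the one by which
  \<^const>\<open>tensor_map\<close> is defined.\<close>
definition free_lift ::
    "('a, 'k) ring_scheme \<Rightarrow> ('a, 'n, 'p) module_scheme \<Rightarrow> ('s \<Rightarrow> 'n) \<Rightarrow> ('s \<Rightarrow> 'a) \<Rightarrow> 'n"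
  where "free_lift A N \<phi> u = (\<Oplus>\<^bsub>N\<^esub>s \<in> {s. u s \<noteq> \<zero>\<^bsub>A\<^esub>}. u s \<odot>\<^bsub>N\<^esub> \<phi> s)"

text \<open>Enlarging the index set only adds zero terms. Additivity needs this, as \<open>u\<close>, \<open>v\<close> and
  \<open>u + v\<close> have different supports and must be summed over a common set.\<close>
lemma free_lift_superset:
  assumes "module A N" "\<phi> \<in> S \<rightarrow> carrier N" "u \<in> carrier (free_module A S)"
    and "finite T" "{s. u s \<noteq> \<zero>\<^bsub>A\<^esub>} \<subseteq> T" "T \<subseteq> S"
  shows "free_lift A N \<phi> u = (\<Oplus>\<^bsub>N\<^esub>s \<in> T. u s \<odot>\<^bsub>N\<^esub> \<phi> s)"
proof -
  interpret N: module A N by fact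
  show ?thesis
    unfolding free_lift_def
    by (rule N.add.finprod_mono_neutral_cong_left)
      (use assms in \<open>auto simp: free_module_simps Pi_iff subset_iff\<close>)
qed

lemma linear_free_lift:
  assumes "module A N" "\<phi> \<in> S \<rightarrow> carrier N"
  shows "free_lift A N \<phi> \<in> linear_maps A (free_module A S) N"
proof -
  interpret N: module A N by fact
  interpret L: module A "free_module A S" by (rule module_free_module) (rule N.R.is_cring)
  note sup = free_lift_superset[OF assms]
  show ?thesis
  proof (rule linear_mapsI)
    fix u assume "u \<in> carrier (free_module A S)"
    then show "free_lift A N \<phi> u \<in> carrier N"
      unfolding free_lift_def using assms(2)
      by (intro N.finsum_closed) (auto simp: free_module_simps Pi_iff subset_iff)
  next
    fix u v assume uv: "u \<in> carrier (free_module A S)" "v \<in> carrier (free_module A S)"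
    define T where "T = {s. u s \<noteq> \<zero>\<^bsub>A\<^esub>} \<union> {s. v s \<noteq> \<zero>\<^bsub>A\<^esub>}"
    have T: "finite T" "T \<subseteq> S" using uv by (auto simp: T_def free_module_simps)
    have uvT: "{s. (u \<oplus>\<^bsub>free_module A S\<^esub> v) s \<noteq> \<zero>\<^bsub>A\<^esub>} \<subseteq> T"
      by (auto simp: T_def free_module_simps)
    have c: "u s \<in> carrier A" "v s \<in> carrier A" for s using uv by (auto simp: free_module_simps)
    have \<phi>: "\<phi> s \<in> carrier N" if "s \<in> T" for s using that T assms(2) by auto
    have "free_lift A N \<phi> (u \<oplus>\<^bsub>free_module A S\<^esub> v)
        = (\<Oplus>\<^bsub>N\<^esub>s \<in> T. (u s \<odot>\<^bsub>N\<^esub> \<phi> s) \<oplus>\<^bsub>N\<^esub> (v s \<odot>\<^bsub>N\<^esub> \<phi> s))"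
      unfolding sup[OF L.a_closed[OF uv] T(1) uvT T(2)]
      by (rule N.finsum_cong') (use c \<phi> in \<open>auto simp: free_module_simps N.smult_l_distr\<close>)
    also have "\<dots> = (\<Oplus>\<^bsub>N\<^esub>s \<in> T. u s \<odot>\<^bsub>N\<^esub> \<phi> s) \<oplus>\<^bsub>N\<^esub> (\<Oplus>\<^bsub>N\<^esub>s \<in> T. v s \<odot>\<^bsub>N\<^esub> \<phi> s)"
      by (rule N.finsum_addf) (use c \<phi> in auto)
    also have "\<dots> = free_lift A N \<phi> u \<oplus>\<^bsub>N\<^esub> free_lift A N \<phi> v"
      using sup[OF uv(1) T(1) _ T(2)] sup[OF uv(2) T(1) _ T(2)] by (simp add: T_def)
    finally show "free_lift A N \<phi> (u \<oplus>\<^bsub>free_module A S\<^esub> v)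
      = free_lift A N \<phi> u \<oplus>\<^bsub>N\<^esub> free_lift A N \<phi> v" .
  next
    fix a u assume a: "a \<in> carrier A" and u: "u \<in> carrier (free_module A S)"
    define T where "T = {s. u s \<noteq> \<zero>\<^bsub>A\<^esub>}"
    have T: "finite T" "T \<subseteq> S" using u by (auto simp: T_def free_module_simps)
    have auT: "{s. (a \<odot>\<^bsub>free_module A S\<^esub> u) s \<noteq> \<zero>\<^bsub>A\<^esub>} \<subseteq> T"
      using a by (auto simp: T_def free_module_simps)
    have c: "u s \<in> carrier A" for s using u by (auto simp: free_module_simps)
    have \<phi>: "\<phi> s \<in> carrier N" if "s \<in> T" for s using that T assms(2) by auto
    have "free_lift A N \<phi> (a \<odot>\<^bsub>free_module A S\<^esub> u) = (\<Oplus>\<^bsub>N\<^esub>s \<in> T. a \<odot>\<^bsub>N\<^esub> (u s \<odot>\<^bsub>N\<^esub> \<phi> s))"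
      unfolding sup[OF L.smult_closed[OF a u] T(1) auT T(2)]
      by (rule N.finsum_cong') (use a c \<phi> in \<open>auto simp: free_module_simps N.smult_assoc1\<close>)
    also have "\<dots> = a \<odot>\<^bsub>N\<^esub> free_lift A N \<phi> u"
      unfolding free_lift_def T_def[symmetric]
      by (rule N.finsum_smult_ldistr[symmetric]) (use T a c \<phi> in auto)
    finally show "free_lift A N \<phi> (a \<odot>\<^bsub>free_module A S\<^esub> u) = a \<odot>\<^bsub>N\<^esub> free_lift A N \<phi> u" .
  qed
qed

lemma free_lift_gen:
  assumes "module A N" "\<phi> \<in> S \<rightarrow> carrier N" "s \<in> S"
  shows "free_lift A N \<phi> (free_gen A s) = \<phi> s"
proof -
  interpret N: module A N by fact
  \<comment> \<open>The support is \<open>{s}\<close>, or empty when \<open>1 = 0\<close>.\<close>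
  have "free_lift A N \<phi> (free_gen A s) = (\<Oplus>\<^bsub>N\<^esub>t \<in> {s}. free_gen A s t \<odot>\<^bsub>N\<^esub> \<phi> t)"
    by (rule free_lift_superset[OF assms(1,2) free_gen_closed])
      (use assms(3) N.R.is_cring in \<open>auto simp: free_gen_def\<close>)
  also have "\<dots> = \<phi> s"
    using funcset_mem[OF assms(2,3)] by (subst N.finsum_insert) (auto simp: free_gen_def)
  finally show ?thesis .
qed

section \<open>Quotient modules\<close>

text \<open>The scalar action on the quotient is a union over representatives. All of them contribute the
  same coset, so the union is that single coset and the coset map is linear; the module laws descend
  along it.\<close>
lemma quotient_module:
  assumes "module A M" "submodule H A M"
  shows module_quotient_module: "module A (quotient_module M H)"
    and linear_coset: "(\<lambda>x. H +>\<^bsub>M\<^esub> x) \<in> linear_maps A M (quotient_module M H)"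
    and carrier_quotient_module: "carrier (quotient_module M H) = (\<lambda>x. H +>\<^bsub>M\<^esub> x) ` carrier M"
    and coset_eq_zero_iff: "x \<in> carrier M \<Longrightarrow> H +>\<^bsub>M\<^esub> x = \<zero>\<^bsub>quotient_module M H\<^esub> \<longleftrightarrow> x \<in> H"
    and coset_self: "x \<in> carrier M \<Longrightarrow> x \<in> H +>\<^bsub>M\<^esub> x"
    and coset_eqI: "\<lbrakk>x \<in> carrier M; y \<in> H +>\<^bsub>M\<^esub> x\<rbrakk> \<Longrightarrow> H +>\<^bsub>M\<^esub> y = H +>\<^bsub>M\<^esub> x"
proof -
  interpret M: module A M by fact
  interpret H: submodule H A M by fact
  interpret H: abelian_subgroup H M
    by (intro abelian_subgroupI3 additive_subgroupI H.subgroup_axioms M.abelian_group_axioms)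
  let ?Q = "quotient_module M H"
  show carrier: "carrier ?Q = (\<lambda>x. H +>\<^bsub>M\<^esub> x) ` carrier M"
    by (auto simp: quotient_module_def A_RCOSETS_def')
  show self: "x \<in> H +>\<^bsub>M\<^esub> x" if "x \<in> carrier M" for x
    using H.a_rcos_self that by simp
  show eqI: "H +>\<^bsub>M\<^esub> y = H +>\<^bsub>M\<^esub> x" if "x \<in> carrier M" "y \<in> H +>\<^bsub>M\<^esub> x" for x y
    using H.a_repr_independence' that by metis
  show "H +>\<^bsub>M\<^esub> x = \<zero>\<^bsub>?Q\<^esub> \<longleftrightarrow> x \<in> H" if "x \<in> carrier M" for x
    using that self[OF that] H.a_rcos_const by (auto simp: quotient_module_def)
  have add: "(H +>\<^bsub>M\<^esub> x) \<oplus>\<^bsub>?Q\<^esub> (H +>\<^bsub>M\<^esub> y) = H +>\<^bsub>M\<^esub> (x \<oplus>\<^bsub>M\<^esub> y)"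
    if "x \<in> carrier M" "y \<in> carrier M" for x y
    using H.a_rcos_sum that by (simp add: quotient_module_def)
  have smult: "a \<odot>\<^bsub>?Q\<^esub> (H +>\<^bsub>M\<^esub> x) = H +>\<^bsub>M\<^esub> (a \<odot>\<^bsub>M\<^esub> x)"
    if a: "a \<in> carrier A" and x: "x \<in> carrier M" for a x
  proof -
    have "H +>\<^bsub>M\<^esub> (a \<odot>\<^bsub>M\<^esub> x') = H +>\<^bsub>M\<^esub> (a \<odot>\<^bsub>M\<^esub> x)" if x': "x' \<in> H +>\<^bsub>M\<^esub> x" for x'
    proof (rule eqI)
      obtain h where "h \<in> H" "x' = h \<oplus>\<^bsub>M\<^esub> x" using x' by (auto simp: a_r_coset_def')
      then show "a \<odot>\<^bsub>M\<^esub> x' \<in> H +>\<^bsub>M\<^esub> (a \<odot>\<^bsub>M\<^esub> x)"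
        using a x by (auto simp: a_r_coset_def' M.smult_r_distr)
    qed (use a x in auto)
    then have "(\<Union>x'\<in>H +>\<^bsub>M\<^esub> x. H +>\<^bsub>M\<^esub> (a \<odot>\<^bsub>M\<^esub> x')) = H +>\<^bsub>M\<^esub> (a \<odot>\<^bsub>M\<^esub> x)"
      using self[OF x] by blast
    then show ?thesis
      by (simp add: quotient_module_def)
  qed
  show "(\<lambda>x. H +>\<^bsub>M\<^esub> x) \<in> linear_maps A M ?Q"
    by (rule linear_mapsI) (auto simp: carrier add smult)
  have zero: "\<zero>\<^bsub>?Q\<^esub> = H +>\<^bsub>M\<^esub> \<zero>\<^bsub>M\<^esub>"
    using M.a_coset_add_zero[OF H.a_subset] by (simp add: quotient_module_def)
  have "\<exists>y\<in>carrier M. H +>\<^bsub>M\<^esub> (y \<oplus>\<^bsub>M\<^esub> x) = H +>\<^bsub>M\<^esub> \<zero>\<^bsub>M\<^esub>" if "x \<in> carrier M" for x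
    using that by (intro bexI[of _ "\<ominus>\<^bsub>M\<^esub> x"]) (simp_all add: M.l_neg)
  then have "abelian_group ?Q"
    by (intro abelian_groupI) (auto simp: carrier add zero M.a_ac simp del: M.a_coset_add_zero)
  then show "module A ?Q"
    by (intro moduleI M.R.is_cring)
      (auto simp: carrier add smult M.smult_l_distr M.smult_r_distr M.smult_assoc1)
qed

lemma coset_eq_iff:
  assumes "module A M" "submodule H A M" "x \<in> carrier M" "y \<in> carrier M"
  shows "H +>\<^bsub>M\<^esub> x = H +>\<^bsub>M\<^esub> y \<longleftrightarrow> x \<ominus>\<^bsub>M\<^esub> y \<in> H"
proof -
  interpret M: module A M by fact
  note Q = quotient_module[OF assms(1,2)]
  have "H +>\<^bsub>M\<^esub> (x \<ominus>\<^bsub>M\<^esub> y) = (H +>\<^bsub>M\<^esub> x) \<ominus>\<^bsub>quotient_module M H\<^esub> (H +>\<^bsub>M\<^esub> y)"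
    by (rule linear_maps_minus[OF assms(1) Q(1,2) assms(3,4)])
  then show ?thesis
    using assms Q(4)[of "x \<ominus>\<^bsub>M\<^esub> y"] minus_eq_zero_iff[OF Q(1)] linear_mapsD(1)[OF Q(2)] by simp
qed

section \<open>Tensor products as a functor\<close>

definition bilinear_map ::
    "('a, 'k) ring_scheme \<Rightarrow> ('a, 'f, 'p) module_scheme \<Rightarrow> ('a, 'n, 'q) module_scheme \<Rightarrow>
     ('a, 'x, 'r) module_scheme \<Rightarrow> ('f \<Rightarrow> 'n \<Rightarrow> 'x) \<Rightarrow> bool"
  where "bilinear_map A F N X b \<longleftrightarrow>
    (\<forall>x\<in>carrier F. b x \<in> linear_maps A N X) \<and> (\<forall>y\<in>carrier N. (\<lambda>x. b x y) \<in> linear_maps A F X)"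

lemma bilinear_mapD:
  assumes "bilinear_map A F N X b" "x \<in> carrier F" "y \<in> carrier N"
  shows "b x y \<in> carrier X"
    and "x' \<in> carrier F \<Longrightarrow> b (x \<oplus>\<^bsub>F\<^esub> x') y = b x y \<oplus>\<^bsub>X\<^esub> b x' y"
    and "y' \<in> carrier N \<Longrightarrow> b x (y \<oplus>\<^bsub>N\<^esub> y') = b x y \<oplus>\<^bsub>X\<^esub> b x y'"
    and "a \<in> carrier A \<Longrightarrow> b (a \<odot>\<^bsub>F\<^esub> x) y = a \<odot>\<^bsub>X\<^esub> b x y"
    and "a \<in> carrier A \<Longrightarrow> b x (a \<odot>\<^bsub>N\<^esub> y) = a \<odot>\<^bsub>X\<^esub> b x y"
proof -
  have N: "b x \<in> linear_maps A N X" and F: "(\<lambda>x. b x y) \<in> linear_maps A F X"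
    using assms by (auto simp: bilinear_map_def)
  show "b x y \<in> carrier X"
    and "y' \<in> carrier N \<Longrightarrow> b x (y \<oplus>\<^bsub>N\<^esub> y') = b x y \<oplus>\<^bsub>X\<^esub> b x y'"
    and "a \<in> carrier A \<Longrightarrow> b x (a \<odot>\<^bsub>N\<^esub> y) = a \<odot>\<^bsub>X\<^esub> b x y"
    using linear_mapsD[OF N] assms(3) by simp_all
  show "x' \<in> carrier F \<Longrightarrow> b (x \<oplus>\<^bsub>F\<^esub> x') y = b x y \<oplus>\<^bsub>X\<^esub> b x' y"
    and "a \<in> carrier A \<Longrightarrow> b (a \<odot>\<^bsub>F\<^esub> x) y = a \<odot>\<^bsub>X\<^esub> b x y"
    using linear_mapsD(2,3)[OF F] assms(2) by simp_all
qed

lemma bilinear_map_compose: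
  assumes "bilinear_map A F N' X b" "f \<in> linear_maps A N N'"
  shows "bilinear_map A F N X (\<lambda>x y. b x (f y))"
proof -
  have "(\<lambda>y. b x (f y)) \<in> linear_maps A N X" if "x \<in> carrier F" for x
    using assms(1) that by (intro linear_maps_compose[OF assms(2)]) (simp add: bilinear_map_def)
  then show ?thesis
    using assms(1) linear_mapsD(1)[OF assms(2)] by (simp add: bilinear_map_def)
qed

context
  fixes A :: "('a, 'k) ring_scheme"
    and F :: "('a, 'f, 'p) module_scheme" and N :: "('a, 'n, 'q) module_scheme"
  assumes F: "module A F" and N: "module A N"
begin

abbreviation "formal_sums \<equiv> free_module A (carrier F \<times> carrier N)"

interpretation F: module A F by (rule F)
interpretation N: module A N by (rule N)
interpretation L: module A formal_sums by (rule module_free_module) (rule F.R.is_cring)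

lemma tensor_gen_closed:
  assumes "x \<in> carrier F" "y \<in> carrier N"
  shows "free_gen A (x, y) \<in> carrier formal_sums"
  using assms by (simp add: free_gen_closed F.R.is_cring)

lemma tensor_relations_subset: "tensor_relations A F N \<subseteq> carrier formal_sums"
  by (auto simp: tensor_relations_def Let_def tensor_gen_closed)

text \<open>The hull is an intersection of submodules, and the family is nonempty because the relations lie
  in the whole free module.\<close>
lemma submodule_tensor_kernel: "submodule (tensor_kernel A F N) A formal_sums"
proof -
  have K: "tensor_kernel A F N = \<Inter>{H. submodule H A formal_sums \<and> tensor_relations A F N \<subseteq> H}"
    by (simp add: tensor_kernel_def hull_def)
  have carrier: "carrier formal_sums \<in> {H. submodule H A formal_sums \<and> tensor_relations A F N \<subseteq> H}"
    using L.carrier_is_submodule tensor_relations_subset by blast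
  have zero: "\<zero>\<^bsub>formal_sums\<^esub> \<in> H" if "submodule H A formal_sums" for H
    by (rule zero_mem_submodule[OF that])
  show ?thesis
    unfolding K
  proof (rule L.submoduleI)
    let ?I = "\<Inter>{H. submodule H A formal_sums \<and> tensor_relations A F N \<subseteq> H}"
    show "?I \<subseteq> carrier formal_sums" using carrier by (rule Inter_lower)
    show "\<zero>\<^bsub>formal_sums\<^esub> \<in> ?I" using zero by simp
    show "\<ominus>\<^bsub>formal_sums\<^esub> u \<in> ?I" if "u \<in> ?I" for u
      using that L.submoduleE(3) by blast
    show "u \<oplus>\<^bsub>formal_sums\<^esub> v \<in> ?I" if "u \<in> ?I" "v \<in> ?I" for u v
      using that L.submoduleE(5) by blast
    show "a \<odot>\<^bsub>formal_sums\<^esub> u \<in> ?I" if "a \<in> carrier A" "u \<in> ?I" for a u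
      using that L.submoduleE(4) by blast
  qed
qed

lemmas tensor_quotient = quotient_module[OF L.module_axioms submodule_tensor_kernel, folded tensor_def]

lemmas module_tensor = tensor_quotient(1)

text \<open>Each of the four families of relations says that one of the four bilinearity laws holds for the
  classes of the generators.\<close>
lemma bilinear_pure_tensor: "bilinear_map A F N (tensor A F N) (pure_tensor A F N)"
proof -
  let ?e = "\<lambda>x y. free_gen A (x, y)"
  let ?\<pi> = "\<lambda>u. tensor_kernel A F N +>\<^bsub>formal_sums\<^esub> u"
  note \<pi> = linear_mapsD[OF tensor_quotient(2)]
  have pure: "pure_tensor A F N x y = ?\<pi> (?e x y)" for x y
    by (simp add: pure_tensor_def)
  have rel: "?\<pi> u = ?\<pi> v"
    if "u \<ominus>\<^bsub>formal_sums\<^esub> v \<in> tensor_relations A F N" "u \<in> carrier formal_sums" "v \<in> carrier formal_sums" for u v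
    using coset_eq_iff[OF L.module_axioms submodule_tensor_kernel that(2,3)] that(1)
      hull_subset[of "tensor_relations A F N"] by (auto simp: tensor_kernel_def)
  note cl = tensor_gen_closed
  have "?\<pi> (?e (x \<oplus>\<^bsub>F\<^esub> x') y) = ?\<pi> (?e x y \<oplus>\<^bsub>formal_sums\<^esub> ?e x' y)"
    if "x \<in> carrier F" "x' \<in> carrier F" "y \<in> carrier N" for x x' y
    by (rule rel, unfold tensor_relations_def Let_def, use that in blast)
      (use that in \<open>simp_all add: cl\<close>)
  moreover have "?\<pi> (?e x (y \<oplus>\<^bsub>N\<^esub> y')) = ?\<pi> (?e x y \<oplus>\<^bsub>formal_sums\<^esub> ?e x y')"
    if "x \<in> carrier F" "y \<in> carrier N" "y' \<in> carrier N" for x y y'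
    by (rule rel, unfold tensor_relations_def Let_def, use that in blast)
      (use that in \<open>simp_all add: cl\<close>)
  moreover have "?\<pi> (?e (a \<odot>\<^bsub>F\<^esub> x) y) = ?\<pi> (a \<odot>\<^bsub>formal_sums\<^esub> ?e x y)"
    if "a \<in> carrier A" "x \<in> carrier F" "y \<in> carrier N" for a x y
    by (rule rel, unfold tensor_relations_def Let_def, use that in blast)
      (use that in \<open>simp_all add: cl\<close>)
  moreover have "?\<pi> (?e x (a \<odot>\<^bsub>N\<^esub> y)) = ?\<pi> (a \<odot>\<^bsub>formal_sums\<^esub> ?e x y)"
    if "a \<in> carrier A" "x \<in> carrier F" "y \<in> carrier N" for a x y
    by (rule rel, unfold tensor_relations_def Let_def, use that in blast)
      (use that in \<open>simp_all add: cl\<close>)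
  ultimately show ?thesis
    by (auto simp: bilinear_map_def pure cl \<pi> intro!: linear_mapsI)
qed

text \<open>The existence half of the universal property: bilinearity of \<open>b\<close> makes its linear extension \<open>h\<close>
  vanish on the relations, hence on the smallest submodule that contains them.\<close>
lemma tensor_kernel_le_kernel:
  assumes "module A X" "bilinear_map A F N X b" "h \<in> linear_maps A formal_sums X"
    and "\<And>x y. \<lbrakk>x \<in> carrier F; y \<in> carrier N\<rbrakk> \<Longrightarrow> h (free_gen A (x, y)) = b x y"
  shows "tensor_kernel A F N \<subseteq> a_kernel formal_sums X h"
proof -
  interpret X: module A X by fact
  note h = linear_mapsD[OF assms(3)] assms(4)
  note b = bilinear_mapD[OF assms(2)]
  have ker: "u \<ominus>\<^bsub>formal_sums\<^esub> v \<in> a_kernel formal_sums X h"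
    if "u \<in> carrier formal_sums" "v \<in> carrier formal_sums" "h u = h v" for u v
    using that linear_maps_minus[OF L.module_axioms assms(1,3)] minus_eq_zero_iff[OF assms(1)] h(1)
    unfolding a_kernel_altdef by (metis (mono_tags, lifting) L.minus_closed mem_Collect_eq)
  have "tensor_relations A F N \<subseteq> a_kernel formal_sums X h"
    unfolding tensor_relations_def Let_def
    by (safe; rule ker; simp add: tensor_gen_closed h b)
  then show ?thesis
    unfolding tensor_kernel_def
    by (rule hull_minimal) (rule submodule_kernel[OF L.module_axioms assms(1,3)])
qed

text \<open>The uniqueness half of the universal property. Every identity between maps \<open>id \<otimes> f\<close> below is
  reduced to pure tensors by it.\<close>
lemma tensor_linear_eqI:
  assumes "module A X" "f \<in> linear_maps A (tensor A F N) X" "g \<in> linear_maps A (tensor A F N) X"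
    and "\<And>x y. \<lbrakk>x \<in> carrier F; y \<in> carrier N\<rbrakk> \<Longrightarrow>
      f (pure_tensor A F N x y) = g (pure_tensor A F N x y)"
    and "z \<in> carrier (tensor A F N)"
  shows "f z = g z"
proof -
  obtain u where u: "u \<in> carrier formal_sums" "z = tensor_kernel A F N +>\<^bsub>formal_sums\<^esub> u"
    using assms(5) tensor_quotient(3) by auto
  show ?thesis
    unfolding u(2)
    by (rule free_module_linear_eqI[OF F.R.is_cring assms(1)
        linear_maps_compose[OF tensor_quotient(2) assms(2)]
        linear_maps_compose[OF tensor_quotient(2) assms(3)] _ u(1)])
      (use assms(4) in \<open>auto simp: pure_tensor_def\<close>)
qed

end

text \<open>The value of the definite description in \<^const>\<open>tensor_map\<close>: the linear extension of
  \<open>(x, y) \<mapsto> x \<otimes> f y\<close> kills the tensor relations of \<open>F\<close> and \<open>N\<close>, so it takes one value on each class.\<close>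
lemma tensor_map_coset:
  assumes "module A F" "module A N" "module A N'" "f \<in> linear_maps A N N'"
    and u: "u \<in> carrier (free_module A (carrier F \<times> carrier N))"
  shows "tensor_map A F N N' f
      (tensor_kernel A F N +>\<^bsub>free_module A (carrier F \<times> carrier N)\<^esub> u) =
    free_lift A (tensor A F N') (\<lambda>p. pure_tensor A F N' (fst p) (f (snd p))) u"
proof -
  interpret F: module A F by fact
  let ?L = "free_module A (carrier F \<times> carrier N)"
  let ?K = "tensor_kernel A F N"
  interpret L: module A ?L by (rule module_free_module) (rule F.R.is_cring)
  let ?\<phi> = "\<lambda>p. pure_tensor A F N' (fst p) (f (snd p))"
  let ?h = "free_lift A (tensor A F N') ?\<phi>"
  have K: "submodule ?K A ?L" by (rule submodule_tensor_kernel) fact+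
  note T' = module_tensor[OF assms(1,3)]
  have b: "bilinear_map A F N (tensor A F N') (\<lambda>x y. pure_tensor A F N' x (f y))"
    by (rule bilinear_map_compose[OF bilinear_pure_tensor[OF assms(1,3)] assms(4)])
  have \<phi>: "?\<phi> \<in> carrier F \<times> carrier N \<rightarrow> carrier (tensor A F N')"
    using bilinear_mapD(1)[OF b] by auto
  note h = linear_free_lift[OF T' \<phi>]
  have ker: "?K \<subseteq> a_kernel ?L (tensor A F N') ?h"
    by (rule tensor_kernel_le_kernel[OF assms(1,2) T' b h])
      (subst free_lift_gen[OF T' \<phi>]; simp)
  have "?h v = ?h u" if v: "v \<in> ?K +>\<^bsub>?L\<^esub> u" for v
  proof -
    have vL: "v \<in> carrier ?L"
      using v L.a_r_coset_subset_G L.submoduleE(1)[OF K] u by blast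
    have "v \<ominus>\<^bsub>?L\<^esub> u \<in> ?K"
      using coset_eqI[OF L.module_axioms K u v] coset_eq_iff[OF L.module_axioms K vL u] by simp
    then have "?h v \<ominus>\<^bsub>tensor A F N'\<^esub> ?h u = \<zero>\<^bsub>tensor A F N'\<^esub>"
      using ker linear_maps_minus[OF L.module_axioms T' h vL u] by (auto simp: a_kernel_altdef)
    then show ?thesis
      using minus_eq_zero_iff[OF T'] linear_mapsD(1)[OF h] vL u by blast
  qed
  then have "(THE Y. \<exists>v\<in>?K +>\<^bsub>?L\<^esub> u. Y = ?h v) = ?h u"
    using coset_self[OF L.module_axioms K u] by (intro the_equality) blast+
  then show ?thesis
    unfolding tensor_map_def free_lift_def .
qed

lemma tensor_map:
  assumes "module A F" "module A N" "module A N'" "f \<in> linear_maps A N N'"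
  shows linear_tensor_map: "tensor_map A F N N' f \<in> linear_maps A (tensor A F N) (tensor A F N')"
    and tensor_map_pure: "\<lbrakk>x \<in> carrier F; y \<in> carrier N\<rbrakk> \<Longrightarrow>
      tensor_map A F N N' f (pure_tensor A F N x y) = pure_tensor A F N' x (f y)"
proof -
  interpret F: module A F by fact
  let ?L = "free_module A (carrier F \<times> carrier N)"
  let ?K = "tensor_kernel A F N"
  interpret L: module A ?L by (rule module_free_module) (rule F.R.is_cring)
  let ?\<phi> = "\<lambda>p. pure_tensor A F N' (fst p) (f (snd p))"
  note T' = module_tensor[OF assms(1,3)]
  note Q = tensor_quotient[OF assms(1,2)]
  have \<phi>: "?\<phi> \<in> carrier F \<times> carrier N \<rightarrow> carrier (tensor A F N')"
    using bilinear_mapD(1)[OF bilinear_pure_tensor[OF assms(1,3)]] linear_mapsD(1)[OF assms(4)]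
    by auto
  note h = linear_mapsD[OF linear_free_lift[OF T' \<phi>]]
  note \<pi> = linear_mapsD[OF Q(2)]
  note map = tensor_map_coset[OF assms]
  show "tensor_map A F N N' f \<in> linear_maps A (tensor A F N) (tensor A F N')"
  proof (rule linear_mapsI)
    fix z w assume "z \<in> carrier (tensor A F N)" "w \<in> carrier (tensor A F N)"
    then obtain u v where u: "u \<in> carrier ?L" "z = ?K +>\<^bsub>?L\<^esub> u"
      and v: "v \<in> carrier ?L" "w = ?K +>\<^bsub>?L\<^esub> v"
      unfolding Q(3) by blast
    have "z \<oplus>\<^bsub>tensor A F N\<^esub> w = ?K +>\<^bsub>?L\<^esub> (u \<oplus>\<^bsub>?L\<^esub> v)"
      using \<pi>(2)[OF u(1) v(1)] u(2) v(2) by simp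
    then show "tensor_map A F N N' f (z \<oplus>\<^bsub>tensor A F N\<^esub> w) =
        tensor_map A F N N' f z \<oplus>\<^bsub>tensor A F N'\<^esub> tensor_map A F N N' f w"
      using h(2)[OF u(1) v(1)] map u v by simp
  next
    fix a z assume a: "a \<in> carrier A" and "z \<in> carrier (tensor A F N)"
    then obtain u where u: "u \<in> carrier ?L" "z = ?K +>\<^bsub>?L\<^esub> u"
      unfolding Q(3) by blast
    have "a \<odot>\<^bsub>tensor A F N\<^esub> z = ?K +>\<^bsub>?L\<^esub> (a \<odot>\<^bsub>?L\<^esub> u)"
      using \<pi>(3)[OF a u(1)] u(2) by simp
    then show "tensor_map A F N N' f (a \<odot>\<^bsub>tensor A F N\<^esub> z) =
        a \<odot>\<^bsub>tensor A F N'\<^esub> tensor_map A F N N' f z"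
      using h(3)[OF a u(1)] a map u by simp
  next
    fix z assume "z \<in> carrier (tensor A F N)"
    then show "tensor_map A F N N' f z \<in> carrier (tensor A F N')"
      unfolding Q(3) using map h(1) by auto
  qed
  show "tensor_map A F N N' f (pure_tensor A F N x y) = pure_tensor A F N' x (f y)"
    if "x \<in> carrier F" "y \<in> carrier N"
    using that free_lift_gen[OF T' \<phi>]
    by (simp add: pure_tensor_def[of A F N] map free_gen_closed F.R.is_cring)
qed

lemma tensor_map_id:
  assumes "module A F" "module A N" "f \<in> linear_maps A N N" "\<And>y. y \<in> carrier N \<Longrightarrow> f y = y"
    and "z \<in> carrier (tensor A F N)"
  shows "tensor_map A F N N f z = z"
  using tensor_linear_eqI[OF assms(1,2) module_tensor[OF assms(1,2)]
      linear_tensor_map[OF assms(1,2,2,3)] linear_maps_id _ assms(5)]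
  by (simp add: tensor_map_pure assms)

lemma tensor_map_compose:
  assumes F: "module A F" and N: "module A N" "module A N'" "module A N''"
    and f: "f \<in> linear_maps A N N'" and g: "g \<in> linear_maps A N' N''"
    and h: "\<And>y. y \<in> carrier N \<Longrightarrow> h y = g (f y)"
    and z: "z \<in> carrier (tensor A F N)"
  shows "tensor_map A F N N'' h z = tensor_map A F N' N'' g (tensor_map A F N N' f z)"
proof -
  have hl: "h \<in> linear_maps A N N''"
    by (rule linear_maps_cong[OF N(1) linear_maps_compose[OF f g] h])
  show ?thesis
    by (rule tensor_linear_eqI[OF F N(1) module_tensor[OF F N(3)] linear_tensor_map[OF F N(1,3) hl]
        linear_maps_compose[OF linear_tensor_map[OF F N(1,2) f] linear_tensor_map[OF F N(2,3) g]] _ z])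
      (simp add: tensor_map_pure[OF F] N f g hl h linear_mapsD(1)[OF f])
qed

lemma tensor_map_smult:
  assumes F: "module A F" and N: "module A N" "module A N'"
    and f: "f \<in> linear_maps A N N'" and s: "s \<in> carrier A"
    and z: "z \<in> carrier (tensor A F N)"
  shows "tensor_map A F N N' (\<lambda>y. s \<odot>\<^bsub>N'\<^esub> f y) z = s \<odot>\<^bsub>tensor A F N'\<^esub> tensor_map A F N N' f z"
  by (rule tensor_linear_eqI[OF F N(1) module_tensor[OF F N(2)]
      linear_tensor_map[OF F N linear_maps_smult[OF N(2) f s]]
      linear_maps_smult[OF module_tensor[OF F N(2)] linear_tensor_map[OF F N f] s] _ z])
    (simp add: tensor_map_pure[OF F N] linear_maps_smult[OF N(2)] f s
      bilinear_mapD(5)[OF bilinear_pure_tensor[OF F N(2)]] linear_mapsD(1)[OF f])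

lemma inverse_linear_maps_tensor_map:
  assumes F: "module A F" and N: "module A N" "module A N'"
    and fg: "inverse_linear_maps A N N' f g"
  shows "inverse_linear_maps A (tensor A F N) (tensor A F N')
    (tensor_map A F N N' f) (tensor_map A F N' N g)"
proof -
  note fg' = fg[unfolded inverse_linear_maps_def]
  have "tensor_map A F N' N g (tensor_map A F N N' f z) = z" if "z \<in> carrier (tensor A F N)" for z
    using tensor_map_compose[OF F N N(1), of f g "\<lambda>y. y" z] tensor_map_id[OF F N(1) linear_maps_id]
      fg' that by simp
  moreover have "tensor_map A F N N' f (tensor_map A F N' N g z) = z"
    if "z \<in> carrier (tensor A F N')" for z
    using tensor_map_compose[OF F N(2,1,2), of g f "\<lambda>y. y" z] tensor_map_id[OF F N(2) linear_maps_id]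
      fg' that by simp
  ultimately show ?thesis
    using fg' linear_tensor_map[OF F N] linear_tensor_map[OF F N(2,1)]
    by (simp add: inverse_linear_maps_def)
qed

section \<open>Faithful flatness over arbitrary types\<close>

text \<open>Faithful flatness is postulated for modules on subsets of one type \<open>'u\<close>. Modules whose carriers
  inject into \<open>'u\<close> have copies there, and both exactness before and exactness after tensoring are
  invariant under isomorphism, the latter because \<open>F \<otimes> -\<close> is a functor.\<close>
lemma faithfully_flat_exact_at_iff:
  fixes N' :: "('a, 'l, 'p1) module_scheme" and N :: "('a, 'm, 'p2) module_scheme"
    and N'' :: "('a, 'n, 'p3) module_scheme"
    and i' :: "'l \<Rightarrow> 'u" and i :: "'m \<Rightarrow> 'u" and i'' :: "'n \<Rightarrow> 'u"
  assumes ff: "faithfully_flat TYPE('u) A F"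
    and mods: "module A N'" "module A N" "module A N''"
    and inj: "inj_on i' (carrier N')" "inj_on i (carrier N)" "inj_on i'' (carrier N'')"
    and f: "f \<in> linear_maps A N' N" and g: "g \<in> linear_maps A N N''"
  shows "exact_at N' N N'' f g \<longleftrightarrow>
    exact_at (tensor A F N') (tensor A F N) (tensor A F N'')
      (tensor_map A F N' N f) (tensor_map A F N N'' g)"
proof -
  have F: "module A F" using ff by (simp add: faithfully_flat_def)
  define K' K K'' where "K' = transport i' N'" and "K = transport i N" and "K'' = transport i'' N''"
  define j' j j'' where "j' = inv_into (carrier N') i'" and "j = inv_into (carrier N) i"
    and "j'' = inv_into (carrier N'') i''"
  note K_defs = K'_def K_def K''_def j'_def j_def j''_def
  have Kmods: "module A K'" "module A K" "module A K''"
    unfolding K_defs by (intro module_transport mods inj)+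
  have iso: "inverse_linear_maps A N' K' i' j'" "inverse_linear_maps A N K i j"
    "inverse_linear_maps A N'' K'' i'' j''"
    unfolding K_defs by (intro inverse_linear_maps_transport mods inj)+
  have lin: "i' \<in> linear_maps A N' K'" "i \<in> linear_maps A N K" "i'' \<in> linear_maps A N'' K''"
    "j' \<in> linear_maps A K' N'" "j \<in> linear_maps A K N" "j'' \<in> linear_maps A K'' N''"
    using iso by (simp_all add: inverse_linear_maps_def)
  define f1 where "f1 = (\<lambda>x. i (f (j' x)))"
  define g1 where "g1 = (\<lambda>y. i'' (g (j y)))"
  have fj: "(\<lambda>x. f (j' x)) \<in> linear_maps A K' N" and gj: "(\<lambda>y. g (j y)) \<in> linear_maps A K N''"
    by (intro linear_maps_compose[OF lin(4) f] linear_maps_compose[OF lin(5) g])+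
  have f1: "f1 \<in> linear_maps A K' K" and g1: "g1 \<in> linear_maps A K K''"
    unfolding f1_def g1_def
    by (intro linear_maps_compose[OF fj lin(2)] linear_maps_compose[OF gj lin(3)])+
  have "exact_at N' N N'' f g \<longleftrightarrow> exact_at K' K K'' f1 g1"
    by (rule exact_at_transfer[OF mods(3) Kmods(3) iso f g]) (simp_all add: f1_def g1_def)
  also have "\<dots> \<longleftrightarrow> exact_at (tensor A F K') (tensor A F K) (tensor A F K'')
      (tensor_map A F K' K f1) (tensor_map A F K K'' g1)"
    using ff Kmods f1 g1 by (simp add: faithfully_flat_def)
  also have "\<dots> \<longleftrightarrow> exact_at (tensor A F N') (tensor A F N) (tensor A F N'')
      (tensor_map A F N' N f) (tensor_map A F N N'' g)"
  proof (rule exact_at_transfer[symmetric,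
        OF module_tensor[OF F mods(3)] module_tensor[OF F Kmods(3)]
          inverse_linear_maps_tensor_map[OF F mods(1) Kmods(1) iso(1)]
          inverse_linear_maps_tensor_map[OF F mods(2) Kmods(2) iso(2)]
          inverse_linear_maps_tensor_map[OF F mods(3) Kmods(3) iso(3)]
          linear_tensor_map[OF F mods(1,2) f] linear_tensor_map[OF F mods(2,3) g]])
    fix z assume z: "z \<in> carrier (tensor A F K')"
    show "tensor_map A F K' K f1 z =
        tensor_map A F N K i (tensor_map A F N' N f (tensor_map A F K' N' j' z))"
      using tensor_map_compose[OF F Kmods(1) mods(2) Kmods(2) fj lin(2) _ z, of f1]
        tensor_map_compose[OF F Kmods(1) mods(1,2) lin(4) f _ z] by (simp add: f1_def)
  next
    fix z assume z: "z \<in> carrier (tensor A F K)"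
    show "tensor_map A F K K'' g1 z =
        tensor_map A F N'' K'' i'' (tensor_map A F N N'' g (tensor_map A F K N j z))"
      using tensor_map_compose[OF F Kmods(2) mods(3) Kmods(3) gj lin(3) _ z, of g1]
        tensor_map_compose[OF F Kmods(2) mods(2,3) lin(5) g _ z] by (simp add: g1_def)
  qed
  finally show ?thesis .
qed

section \<open>Residuals and the classical 1-absorbing prime property\<close>

text \<open>The residual, or colon submodule, \<open>(P :\<^sub>M s)\<close>.\<close>
definition residual :: "('a, 'm, 'p) module_scheme \<Rightarrow> 'm set \<Rightarrow> 'a \<Rightarrow> 'm set"
  where "residual M P s = {m \<in> carrier M. s \<odot>\<^bsub>M\<^esub> m \<in> P}"

lemma submodule_residual:
  assumes "module A M" "submodule P A M" "s \<in> carrier A"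
  shows "submodule (residual M P s) A M"
proof -
  interpret M: module A M by fact
  note P = M.submoduleE[OF assms(2)]
  note zero = zero_mem_submodule[OF assms(2)]
  show ?thesis
  proof (rule M.submoduleI)
    fix a x assume a: "a \<in> carrier A" and x: "x \<in> residual M P s"
    then have "s \<odot>\<^bsub>M\<^esub> (a \<odot>\<^bsub>M\<^esub> x) = a \<odot>\<^bsub>M\<^esub> (s \<odot>\<^bsub>M\<^esub> x)"
      using assms(3) by (simp add: residual_def M.m_comm flip: M.smult_assoc1)
    then show "a \<odot>\<^bsub>M\<^esub> x \<in> residual M P s"
      using a x P(4) by (simp add: residual_def)
  qed (use assms(3) zero P in \<open>auto simp: residual_def M.smult_r_distr M.smult_r_minus\<close>)
qed

lemma residual_mult_subset:
  assumes "module A M" "submodule P A M" "s \<in> carrier A" "t \<in> carrier A"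
  shows "residual M P t \<subseteq> residual M P (s \<otimes>\<^bsub>A\<^esub> t)" "residual M P t \<subseteq> residual M P (t \<otimes>\<^bsub>A\<^esub> s)"
proof -
  interpret M: module A M by fact
  show "residual M P t \<subseteq> residual M P (s \<otimes>\<^bsub>A\<^esub> t)"
    using assms M.submoduleE(4)[OF assms(2)] by (auto simp: residual_def M.smult_assoc1)
  then show "residual M P t \<subseteq> residual M P (t \<otimes>\<^bsub>A\<^esub> s)"
    using assms by (simp add: M.m_comm)
qed

text \<open>If \<open>x\<close> lies only in \<open>H\<close> and \<open>y\<close> only in \<open>K\<close>, then \<open>x + y\<close> can lie in neither.\<close>
lemma submodule_eq_union:
  assumes "module A M" "submodule H A M" "submodule K A M" and sub: "submodule (H \<union> K) A M"
  shows "H \<union> K = H \<or> H \<union> K = K"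
proof (rule ccontr)
  interpret M: module A M by fact
  note H = M.submoduleE[OF assms(2)] and K = M.submoduleE[OF assms(3)]
  assume "\<not> ?thesis"
  then obtain x y where x: "x \<in> H" "x \<notin> K" and y: "y \<in> K" "y \<notin> H" by blast
  then have c: "x \<in> carrier M" "y \<in> carrier M" using H(1) K(1) by auto
  have "x \<oplus>\<^bsub>M\<^esub> y \<in> H \<union> K" using M.submoduleE(5)[OF sub] x y by blast
  then show False
  proof
    assume "x \<oplus>\<^bsub>M\<^esub> y \<in> H"
    then have "\<ominus>\<^bsub>M\<^esub> x \<oplus>\<^bsub>M\<^esub> (x \<oplus>\<^bsub>M\<^esub> y) \<in> H" using H(3,5) x by blast
    then show False using c y by (simp add: M.r_neg1)
  next
    assume "x \<oplus>\<^bsub>M\<^esub> y \<in> K"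
    then have "\<ominus>\<^bsub>M\<^esub> y \<oplus>\<^bsub>M\<^esub> (y \<oplus>\<^bsub>M\<^esub> x) \<in> K" using K(3,5) y c by (simp add: M.a_comm)
    then show False using c x by (simp add: M.r_neg1)
  qed
qed

text \<open>For fixed \<open>a\<close>, \<open>b\<close>, \<open>c\<close> the defining condition says that \<open>(P : abc)\<close> is the union of
  \<open>(P : ab)\<close> and \<open>(P : c)\<close>, both of which it always contains. A submodule that is the union of two
  submodules equals one of them. This removes the elements \<open>m\<close> from the condition and leaves
  equalities of submodules, which a faithfully flat module preserves and reflects.\<close>
lemma classical_1_absorbing_prime_iff_residuals:
  assumes "module A M" "submodule P A M"
  shows "classical_1_absorbing_prime_submodule A M P \<longleftrightarrow> P \<noteq> carrier M \<and>
    (\<forall>a \<in> carrier A - Units A. \<forall>b \<in> carrier A - Units A. \<forall>c \<in> carrier A - Units A.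
      residual M P (a \<otimes>\<^bsub>A\<^esub> b \<otimes>\<^bsub>A\<^esub> c) = residual M P (a \<otimes>\<^bsub>A\<^esub> b) \<or>
      residual M P (a \<otimes>\<^bsub>A\<^esub> b \<otimes>\<^bsub>A\<^esub> c) = residual M P c)"
proof -
  interpret M: module A M by fact
  have "(\<forall>m \<in> carrier M. (a \<otimes>\<^bsub>A\<^esub> b \<otimes>\<^bsub>A\<^esub> c) \<odot>\<^bsub>M\<^esub> m \<in> P \<longrightarrow>
        (a \<otimes>\<^bsub>A\<^esub> b) \<odot>\<^bsub>M\<^esub> m \<in> P \<or> c \<odot>\<^bsub>M\<^esub> m \<in> P) \<longleftrightarrow>
      residual M P (a \<otimes>\<^bsub>A\<^esub> b \<otimes>\<^bsub>A\<^esub> c) = residual M P (a \<otimes>\<^bsub>A\<^esub> b) \<or>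
      residual M P (a \<otimes>\<^bsub>A\<^esub> b \<otimes>\<^bsub>A\<^esub> c) = residual M P c" (is "?pointwise \<longleftrightarrow> ?R = ?H \<or> ?R = ?K")
    if "a \<in> carrier A" "b \<in> carrier A" "c \<in> carrier A" for a b c
  proof -
    have sub: "?H \<union> ?K \<subseteq> ?R"
      using residual_mult_subset[OF assms] that by (metis M.m_closed Un_least)
    then have "?pointwise \<longleftrightarrow> ?R = ?H \<union> ?K"
      by (auto simp: residual_def)
    also have "\<dots> \<longleftrightarrow> ?R = ?H \<or> ?R = ?K"
    proof
      assume eq: "?R = ?H \<union> ?K"
      have "submodule ?R A M" "submodule ?H A M" "submodule ?K A M"
        using that by (simp_all add: submodule_residual[OF assms])
      then show "?R = ?H \<or> ?R = ?K"
        using submodule_eq_union[OF assms(1), of ?H ?K] unfolding eq by blast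
    qed (use sub in blast)
    finally show ?thesis .
  qed
  then show ?thesis
    using assms(2) by (simp add: classical_1_absorbing_prime_submodule_def)
qed

section \<open>Residuals under a faithfully flat module\<close>

lemma linear_submodule_inclusion:
  assumes "Q \<subseteq> carrier M"
  shows "(\<lambda>x. x) \<in> linear_maps A (M\<lparr>carrier := Q\<rparr>) M"
  by (rule linear_mapsI) (use assms in auto)

lemma submodule_tensor_submodule:
  assumes "module A F" "module A M" "submodule P A M"
  shows "submodule (tensor_submodule A F M P) A (tensor A F M)"
proof -
  have P: "module A (M\<lparr>carrier := P\<rparr>)" by (rule submodule.submodule_is_module[OF assms(3,2)])
  have "(\<lambda>x. x) \<in> linear_maps A (M\<lparr>carrier := P\<rparr>) M"
    by (rule linear_submodule_inclusion) (rule module.submoduleE(1)[OF assms(2,3)])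
  then show ?thesis
    unfolding tensor_submodule_def
    by (intro submodule_image[OF module_tensor[OF assms(1) P] module_tensor[OF assms(1,2)]]
        linear_tensor_map[OF assms(1) P assms(2)])
qed

lemma tensor_submodule_carrier:
  assumes "module A F" "module A M"
  shows "tensor_submodule A F M (carrier M) = carrier (tensor A F M)"
  using tensor_map_id[OF assms linear_maps_id] by (simp add: tensor_submodule_def)

text \<open>Let \<open>\<pi>\<close> be the projection \<open>M \<rightarrow> M/P\<close>. A submodule \<open>N\<close> equals \<open>(P : t)\<close> iff
  \<open>N \<rightarrow> M \<rightarrow> M/P\<close>, with second map \<open>t \<cdot> \<pi>\<close>, is exact, that is, iff \<open>F \<otimes> N\<close> is the kernel of
  \<open>t \<cdot> (id \<otimes> \<pi>)\<close>. The case \<open>N = P\<close>, \<open>t = 1\<close> identifies the kernel of \<open>id \<otimes> \<pi>\<close> with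
  \<open>F \<otimes> P\<close>, so the kernel of \<open>s \<cdot> (id \<otimes> \<pi>)\<close> is \<open>(F \<otimes> P : s)\<close>. The equivalence serves twice: with
  \<open>Q = (P : s)\<close> it says that residuals commute with \<open>F \<otimes> -\<close>, and with \<open>s = 1\<close> that
  \<open>F \<otimes> Q = F \<otimes> P\<close> forces \<open>Q = P\<close>. The injection \<open>j\<close> makes room in \<open>'u\<close> for the cosets that form
  \<open>M/P\<close>, and through singletons for \<open>M\<close> and its submodules.\<close>
lemma faithfully_flat_residual_iff:
  fixes j :: "'m set \<Rightarrow> 'u" and M :: "('a, 'm, 'p) module_scheme"
  assumes ff: "faithfully_flat TYPE('u) A F" and j: "inj j"
    and M: "module A M" and P: "submodule P A M" and Q: "submodule Q A M" and s: "s \<in> carrier A"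
  shows "Q = residual M P s \<longleftrightarrow>
    tensor_submodule A F M Q = residual (tensor A F M) (tensor_submodule A F M P) s"
proof -
  have F: "module A F" using ff by (simp add: faithfully_flat_def)
  interpret M: module A M by fact
  let ?\<pi> = "\<lambda>m. P +>\<^bsub>M\<^esub> m" and ?M' = "quotient_module M P"
  note quot = quotient_module[OF M P]
  interpret M': module A ?M' by (rule quot(1))
  let ?T = "tensor A F M" and ?T\<pi> = "tensor_map A F M ?M' ?\<pi>"
  interpret T: module A ?T by (rule module_tensor[OF F M])
  note T\<pi> = linear_tensor_map[OF F M quot(1,2)]
  have j1: "inj_on (\<lambda>m. j {m}) X" for X
    by (rule inj_onI) (drule injD[OF j], simp)
  have flat: "N = residual M P t \<longleftrightarrow>
      tensor_submodule A F M N = {z \<in> carrier ?T. ?T\<pi> (t \<odot>\<^bsub>?T\<^esub> z) = \<zero>\<^bsub>tensor A F ?M'\<^esub>}"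
    if N: "submodule N A M" and t: "t \<in> carrier A" for N t
  proof -
    let ?g = "\<lambda>m. t \<odot>\<^bsub>?M'\<^esub> ?\<pi> m"
    have NM: "N \<subseteq> carrier M" by (rule M.submoduleE(1)[OF N])
    have "?g m = \<zero>\<^bsub>?M'\<^esub> \<longleftrightarrow> t \<odot>\<^bsub>M\<^esub> m \<in> P" if "m \<in> carrier M" for m
      using quot(4)[of "t \<odot>\<^bsub>M\<^esub> m"] linear_mapsD(3)[OF quot(2) t that] t that by simp
    then have "a_kernel M ?M' ?g = residual M P t"
      unfolding a_kernel_altdef residual_def by blast
    then have "N = residual M P t \<longleftrightarrow> exact_at (M\<lparr>carrier := N\<rparr>) M ?M' (\<lambda>x. x) ?g"
      by (simp add: exact_at_def)
    also have "\<dots> \<longleftrightarrow> exact_at (tensor A F (M\<lparr>carrier := N\<rparr>)) ?T (tensor A F ?M')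
        (tensor_map A F (M\<lparr>carrier := N\<rparr>) M (\<lambda>x. x)) (tensor_map A F M ?M' ?g)"
      by (rule faithfully_flat_exact_at_iff[OF ff submodule.submodule_is_module[OF N M] M quot(1)
            j1 j1 inj_on_subset[OF j subset_UNIV]
            linear_submodule_inclusion[OF NM] linear_maps_smult[OF quot(1,2) t]])
    also have "\<dots> \<longleftrightarrow> tensor_submodule A F M N = a_kernel ?T (tensor A F ?M') (tensor_map A F M ?M' ?g)"
      by (simp add: exact_at_def tensor_submodule_def)
    also have "a_kernel ?T (tensor A F ?M') (tensor_map A F M ?M' ?g) =
        {z \<in> carrier ?T. ?T\<pi> (t \<odot>\<^bsub>?T\<^esub> z) = \<zero>\<^bsub>tensor A F ?M'\<^esub>}"
      unfolding a_kernel_altdef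
      using tensor_map_smult[OF F M quot(1,2) t] linear_mapsD(3)[OF T\<pi> t]
      by (intro Collect_cong conj_cong refl) simp
    finally show ?thesis .
  qed
  have "P = residual M P \<one>\<^bsub>A\<^esub>"
    using M.submoduleE(1)[OF P] by (auto simp: residual_def)
  then have "tensor_submodule A F M P = {z \<in> carrier ?T. ?T\<pi> z = \<zero>\<^bsub>tensor A F ?M'\<^esub>}"
    using flat[OF P M.R.one_closed] by (simp cong: conj_cong)
  then have "residual ?T (tensor_submodule A F M P) s =
      {z \<in> carrier ?T. ?T\<pi> (s \<odot>\<^bsub>?T\<^esub> z) = \<zero>\<^bsub>tensor A F ?M'\<^esub>}"
    using s by (auto simp: residual_def)
  then show ?thesis
    using flat[OF Q s] by simp
qed

theorem theorem8:
  fixes A :: "('a, 'k) ring_scheme"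
    and M :: "('a, 'm, 'p) module_scheme"
    and F :: "('a, 'f, 'q) module_scheme"
    and P :: "'m set"
  assumes "cring A" and "\<one>\<^bsub>A\<^esub> \<noteq> \<zero>\<^bsub>A\<^esub>"
    and "module A M" and "carrier M \<noteq> {\<zero>\<^bsub>M\<^esub>}"
    and "submodule P A M"
    and "module A F" and "carrier F \<noteq> {\<zero>\<^bsub>F\<^esub>}"
    and "faithfully_flat TYPE(('a + 'm) set) A F"
  shows "classical_1_absorbing_prime_submodule A M P \<longleftrightarrow>
    classical_1_absorbing_prime_submodule A (tensor A F M) (tensor_submodule A F M P)"
proof -
  interpret A: cring A by fact
  interpret M: module A M by fact
  let ?T = "tensor A F M" and ?FP = "tensor_submodule A F M P"
  have "inj (image Inr :: 'm set \<Rightarrow> ('a + 'm) set)"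
    by (simp add: inj_on_def inj_image_eq_iff)
  note flat = faithfully_flat_residual_iff[OF assms(8) this assms(3)]
  have residual: "tensor_submodule A F M (residual M P s) = residual ?T ?FP s" if "s \<in> carrier A" for s
    using flat[OF assms(5) submodule_residual[OF assms(3,5) that] that] by simp
  have inj: "tensor_submodule A F M Q = tensor_submodule A F M Q' \<longleftrightarrow> Q = Q'"
    if Q: "submodule Q A M" "submodule Q' A M" for Q Q'
  proof -
    have "Q' = residual M Q' \<one>\<^bsub>A\<^esub>"
      using M.submoduleE(1)[OF Q(2)] by (auto simp: residual_def)
    then show ?thesis
      using flat[OF Q(2,1) A.one_closed] flat[OF Q(2,2) A.one_closed] by metis
  qed
  have "?FP = carrier ?T \<longleftrightarrow> P = carrier M"
    using inj[OF assms(5) M.carrier_is_submodule] tensor_submodule_carrier[OF assms(6,3)] by simp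
  moreover have "residual ?T ?FP s = residual ?T ?FP t \<longleftrightarrow> residual M P s = residual M P t"
    if "s \<in> carrier A" "t \<in> carrier A" for s t
    using inj submodule_residual[OF assms(3,5)] that by (simp flip: residual)
  ultimately show ?thesis
    unfolding classical_1_absorbing_prime_iff_residuals[OF assms(3,5)]
      classical_1_absorbing_prime_iff_residuals[OF module_tensor[OF assms(6,3)]
        submodule_tensor_submodule[OF assms(6,3,5)]]
    by simp
qed

end
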